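(* Let $K\ge1$ and $q=(q_1,\dots,q_K)\in(0,1)^K$. Let $u(i,j)$, $i\ge1$, $1\le j\le K$, be independent random variables with $P\{u(i,j)=k\}=(1-q_j)q_j^k$ for $k\in\mathbb{N}=\{0,1,\dots\}$. For each $N\ge1$ let $D^{(N)}$ be the instant of departure of customer $N$ from queue $K$ and $R^{(N)}$ the cumulative departures over time slots $1$ to $N$ from store $K$, defined as follows. Queues: $D(0,j)=D(n,0)=0$, $D(n,j)=\max(D(n-1,j),D(n,j-1))+u(n,j)$ for $n,j\ge1$, and $D^{(N)}=D(N,K)$. Stores: $R_1(0)=0$, $R_1(n)=u(n,K)$ for $n\ge1$; for $k=2,\dots,K$: $L_k(0)=R_k(0)=0$ and for $n\ge1$, $S_k(n)=R_{k-1}(n-1)$, $R_k(n)=\min(L_k(n-1)+S_k(n),u(n,K+1-k))$, $L_k(n)=L_k(n-1)+S_k(n)-R_k(n)$; and $R^{(N)}=\sum_{n=1}^N R_K(n)$. Then the law of the sequence $(D^{(N)},R^{(N)})_{N\ge1}$ is unchanged if the parameters $(q_1,\dots,q_K)$ are replaced by $(q_{\sigma(1)},\dots,q_{\sigma(K)})$, for any permutation $\sigma$ of $\{1,\dots,K\}$.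
   Context: $D(n,j)$ is the departure time of customer $n$ from queue $j$ in a tandem of $K$ FIFO single-server queues, initially empty except for infinitely many customers waiting at queue 1, with $u(i,j)$ the service time of customer $i$ at queue $j$. $R_k(n)$ is the amount departing at slot $n$ from store $k$ in a tandem of $K$ stores where store 1 has infinite stock, the request at slot $n$ in store $k$ is $u(n,K+1-k)$, unmet demand is lost, and the departure from store $k$ at slot $n$ is the supply of store $k+1$ at slot $n+1$. *)

theory Defs
  imports "HOL-Probability.Probability" "HOL-Combinatorics.Permutations"
begin

text \<open>An array \<open>v i j\<close> (customer or slot \<open>i\<close>, queue \<open>j\<close>) is one realisation of the service times.
  Indices start at 1; entries outside \<open>i \<ge> 1\<close>, \<open>1 \<le> j \<le> K\<close> play no role.\<close>

fun departure_time :: "(nat \<Rightarrow> nat \<Rightarrow> nat) \<Rightarrow> nat \<Rightarrow> nat \<Rightarrow> nat" where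
  "departure_time v 0 j = 0"
| "departure_time v (Suc n) 0 = 0"
| "departure_time v (Suc n) (Suc j) =
     max (departure_time v n (Suc j)) (departure_time v (Suc n) j) + v (Suc n) (Suc j)"

text \<open>\<open>store_departure K v k n\<close> is \<open>R\<^sub>k(n)\<close> and \<open>store_level K v k n\<close> is \<open>L\<^sub>k(n)\<close>. The supply
  \<open>S\<^sub>k(n) = R\<^sub>k\<^sub>-\<^sub>1(n - 1)\<close> is written out. Store 1 has infinite stock, so \<open>store_level K v k\<close> is
  meaningful for \<open>2 \<le> k \<le> K\<close> only, and \<open>store_departure K v k\<close> for \<open>1 \<le> k \<le> K\<close> only.
  The subtraction in \<open>store_level\<close> is never truncated when \<open>k \<ge> 2\<close>, since the departure is at most
  the level plus the supply.\<close>

fun store_departure :: "nat \<Rightarrow> (nat \<Rightarrow> nat \<Rightarrow> nat) \<Rightarrow> nat \<Rightarrow> nat \<Rightarrow> nat"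
  and store_level :: "nat \<Rightarrow> (nat \<Rightarrow> nat \<Rightarrow> nat) \<Rightarrow> nat \<Rightarrow> nat \<Rightarrow> nat" where
  "store_departure K v k 0 = 0"
| "store_departure K v k (Suc n) =
     (if k \<le> 1 then v (Suc n) K
      else min (store_level K v k n + store_departure K v (k - 1) n) (v (Suc n) (K + 1 - k)))"
| "store_level K v k 0 = 0"
| "store_level K v k (Suc n) =
     store_level K v k n + store_departure K v (k - 1) n - store_departure K v k (Suc n)"

definition cumulative_departures :: "nat \<Rightarrow> (nat \<Rightarrow> nat \<Rightarrow> nat) \<Rightarrow> nat \<Rightarrow> nat" where
  "cumulative_departures K v N = (\<Sum>n = 1..N. store_departure K v K n)"

definition geometric_service_times ::
    "'a measure \<Rightarrow> nat \<Rightarrow> (nat \<Rightarrow> real) \<Rightarrow> (nat \<Rightarrow> nat \<Rightarrow> 'a \<Rightarrow> nat) \<Rightarrow> bool" where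
  "geometric_service_times M K q u \<longleftrightarrow>
     prob_space.indep_vars M (\<lambda>_. count_space UNIV) (\<lambda>(i, j). u i j) ({1..} \<times> {1..K}) \<and>
     (\<forall>i\<ge>1. \<forall>j\<in>{1..K}. \<forall>k. measure M {\<omega> \<in> space M. u i j \<omega> = k} = (1 - q j) * q j ^ k)"

definition departure_law :: "'a measure \<Rightarrow> nat \<Rightarrow> (nat \<Rightarrow> nat \<Rightarrow> 'a \<Rightarrow> nat) \<Rightarrow> (nat \<Rightarrow> nat \<times> nat) measure"
  where
  "departure_law M K u =
     distr M (Pi\<^sub>M {1..} (\<lambda>_. count_space UNIV))
       (\<lambda>\<omega>. \<lambda>N\<in>{1..}. (departure_time (\<lambda>i j. u i j \<omega>) N K,
                        cumulative_departures K (\<lambda>i j. u i j \<omega>) N))"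

end

theory Submission
  imports Defs
begin

text \<open>
  It suffices to exchange \<open>q\<^sub>j\<close> and \<open>q\<^sub>j\<^sub>+\<^sub>1\<close>. Given the departures from queue \<open>j - 1\<close>, those from
  queue \<open>j + 1\<close> depend on the columns \<open>w = u(\<cdot>, j)\<close>, \<open>x = u(\<cdot>, j + 1)\<close> only through the
  last-passage times \<open>G(m, n) = max\<^sub>l (w\<^sub>m + \<dots> + w\<^sub>l + x\<^sub>l + \<dots> + x\<^sub>n)\<close>, and dually the stores depend on
  them only through the minima of \<open>x\<^sub>m + \<dots> + x\<^sub>l\<^sub>-\<^sub>1 + w\<^sub>l\<^sub>+\<^sub>1 + \<dots> + w\<^sub>n\<close>, which are \<open>G(m, n)\<close> subtracted
  from the total of rows \<open>m, \<dots>, n\<close>. On a finite horizon \<open>N\<close>, read row \<open>i\<close> as the word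
  \<open>)\<dots>)(\<dots>(\<close> with \<open>w\<^sub>i\<close> closing and \<open>x\<^sub>i\<close> opening brackets. After matching brackets in the concatenation
  of all rows, the unmatched ones form \<open>)\<^sup>p(\<^sup>r\<close>; replacing them by \<open>)\<^sup>r(\<^sup>p\<close> (the crystal reflection of
  type \<open>A\<^sub>1\<close>) is an involution that keeps the row sums and all \<open>G(m, n)\<close> but exchanges the two column
  sums. As the geometric weight of an array depends only on its column sums, the involution carries
  the law with parameters \<open>q\<close> to the one with \<open>q\<^sub>j\<close>, \<open>q\<^sub>j\<^sub>+\<^sub>1\<close> exchanged and leaves the output unchanged.
\<close>

section \<open>The reflection of a bracket word\<close>

text \<open>A pair \<open>(w, x)\<close> encodes \<open>w\<close> closing brackets followed by \<open>x\<close> opening ones; \<open>closers\<close> and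
  \<open>openers\<close> count the brackets left unmatched, and \<open>reclose t\<close> changes the unmatched ones so that
  the first \<open>t\<close> are closing and the rest opening.\<close>

fun closers :: "(nat \<times> nat) list \<Rightarrow> nat" where
  "closers [] = 0"
| "closers ((w, x) # l) = w + (closers l - x)"

fun openers :: "(nat \<times> nat) list \<Rightarrow> nat" where
  "openers [] = 0"
| "openers ((w, x) # l) = openers l + (x - closers l)"

fun reclose :: "nat \<Rightarrow> (nat \<times> nat) list \<Rightarrow> (nat \<times> nat) list" where
  "reclose t [] = []"
| "reclose t ((w, x) # l) =
     (let h = min t (w + (x - closers l))
      in (h, w + x - h) # reclose (min (closers l) x + (t - h)) l)"

lemma length_reclose [simp]: "length (reclose t l) = length l"
  by (induction t l rule: reclose.induct) (auto simp: Let_def)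


text \<open>The target \<open>c\<close> of the tail consists of the closers matched to openers of
  the first row and of the \<open>t - h\<close> unmatched ones still to be placed. The final
  identities say that the row keeps its size, its number of unmatched brackets and its number of
  matched pairs; the inductions below rest on them.\<close>

lemma reclose_Cons:
  assumes "t \<le> closers ((w, x) # l) + openers ((w, x) # l)"
  obtains h c where "reclose t ((w, x) # l) = (h, w + x - h) # reclose c l"
    "h = min t (w + (x - closers l))" "c = min (closers l) x + (t - h)"
    "c \<le> closers l + openers l" "h + (w + x - h) = w + x" "h + (c - (w + x - h)) = t"
    "h + (w + x - h - c) = w + (x - closers l)" "min c (w + x - h) = min (closers l) x"
proof -
  define h where "h = min t (w + (x - closers l))"
  define c where "c = min (closers l) x + (t - h)"
  show ?thesis
  proof
    show "h = min t (w + (x - closers l))" "c = min (closers l) x + (t - h)"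
      by (fact h_def c_def)+
    show "reclose t ((w, x) # l) = (h, w + x - h) # reclose c l"
      by (simp add: Let_def h_def c_def)
    show "c \<le> closers l + openers l" "h + (w + x - h) = w + x" "h + (c - (w + x - h)) = t"
      "h + (w + x - h - c) = w + (x - closers l)" "min c (w + x - h) = min (closers l) x"
      using assms [[linarith_split_limit = 30]] unfolding closers.simps openers.simps c_def h_def
      by linarith+
  qed
qed

lemma closers_reclose:
  "t \<le> closers l + openers l \<Longrightarrow> closers (reclose t l) = t"
proof (induction l arbitrary: t)
  case (Cons b l)
  obtain w x where b: "b = (w, x)" by force
  from Cons.prems obtain h c where hc:
    "reclose t ((w, x) # l) = (h, w + x - h) # reclose c l"
    "c \<le> closers l + openers l" "h + (c - (w + x - h)) = t"
    unfolding b by (elim reclose_Cons)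
  then show ?case
    unfolding b hc(1) closers.simps Cons.IH[OF hc(2)] by blast
qed simp

lemma openers_reclose:
  "t \<le> closers l + openers l \<Longrightarrow> openers (reclose t l) = closers l + openers l - t"
proof (induction l arbitrary: t)
  case (Cons b l)
  obtain w x where b: "b = (w, x)" by force
  from Cons.prems obtain h c where hc:
    "reclose t ((w, x) # l) = (h, w + x - h) # reclose c l"
    "c \<le> closers l + openers l" "h + (w + x - h) = w + x" "h + (c - (w + x - h)) = t"
    "h + (w + x - h - c) = w + (x - closers l)" "min c (w + x - h) = min (closers l) x"
    unfolding b by (elim reclose_Cons)
  have "openers (reclose t ((w, x) # l)) = closers l + openers l - c + (w + x - h - c)"
    using hc(2) by (simp add: hc(1) closers_reclose Cons.IH del: reclose.simps)
  also have "\<dots> = closers (b # l) + openers (b # l) - t"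
    using hc(2-) [[linarith_split_limit = 30]] unfolding b closers.simps openers.simps by linarith
  finally show ?case by (simp only: b)
qed simp

lemma reclose_closers: "reclose (closers l) l = l"
proof (induction l)
  case (Cons b l)
  obtain w x where b: "b = (w, x)" by force
  obtain h c where "reclose (closers (b # l)) (b # l) = (h, w + x - h) # reclose c l"
    and h: "h = min (closers (b # l)) (w + (x - closers l))"
    and c: "c = min (closers l) x + (closers (b # l) - h)"
    using reclose_Cons[of "closers (b # l)" w x l] unfolding b by auto
  moreover have "h = w" "c = closers l"
    using h c [[linarith_split_limit = 30]] unfolding b closers.simps by linarith+
  ultimately show ?case using Cons.IH b by simp
qed simp

text \<open>\<open>reclose t'\<close> reads only row totals, numbers of unmatched brackets and
  numbers of matched pairs, and \<open>reclose t\<close> keeps all three.\<close>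

lemma reclose_reclose:
  "t \<le> closers l + openers l \<Longrightarrow> reclose t' (reclose t l) = reclose t' l"
proof (induction l arbitrary: t t')
  case (Cons b l)
  obtain w x where b: "b = (w, x)" by force
  from Cons.prems obtain h c where hc:
    "reclose t ((w, x) # l) = (h, w + x - h) # reclose c l"
    "c \<le> closers l + openers l" "h + (w + x - h) = w + x" 
    "h + (w + x - h - c) = w + (x - closers l)" "min c (w + x - h) = min (closers l) x"
    unfolding b by (elim reclose_Cons)
  have "reclose t' ((h, w + x - h) # reclose c l) = reclose t' ((w, x) # l)"
    by (simp only: reclose.simps closers_reclose hc(2-) Cons.IH)
  then show ?case by (simp only: b hc(1))
qed simp

text \<open>Cancelling matched pairs removes as many closing as opening brackets.\<close>

lemma closers_balance: "closers l + sum_list (map snd l) = openers l + sum_list (map fst l)"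
  by (induction l rule: closers.induct) auto

lemma sum_reclose: "map (\<lambda>(w, x). w + x) (reclose t l) = map (\<lambda>(w, x). w + x) l"
  by (induction t l rule: reclose.induct) (auto simp: Let_def)


text \<open>The openers left by \<open>l\<close> cancel against the closers left by
  \<open>m\<close>, as in the bicyclic monoid.\<close>

lemma closers_append: "closers (l @ m) = closers l + (closers m - openers l)"
  by (induction l rule: closers.induct) auto

lemma openers_append: "openers (l @ m) = openers m + (openers l - closers m)"
  by (induction l rule: closers.induct) (auto simp: closers_append)

text \<open>Arithmetic core of \<open>reclose_append\<close>: \<open>p\<close>, \<open>r\<close> are
  the closers and openers of the left word without its first row, \<open>k\<close> the closers of
  the right word. Peeling off the first row and cutting between the words must commute. The case
  distinctions name the differences, which resolves nested truncated subtractions.\<close>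

lemma reclose_append_aux:
  fixes x t w p k r::nat
assumes h_def: "h = min t (w + (x - (p + (k - r))))" 
and c_def: "c = min (p + (k - r)) x + (t - h)"
and a'_def: "a' = min c (p + (r - k))" and a: "a = min t (w + (p - x) + (r + (x - p) - k))"
shows "a' = min p x + (a-h)" "min k r + (c - a') = min k (r + (x - p)) + (t - a)"
proof -
  have "a' = min p x + (a-h) \<and> min k r + (c - a') = min k (r + (x - p)) + (t - a)"
  proof (cases "x \<le> p")
    case True
    then obtain d where d: "p = x + d" using le_Suc_ex by blast
    have *: "h = min t w" "c = x + (t - h)" "a = min t (w + d + (r - k))" "a' = min c (x + d + (r - k))"
      using h_def c_def a a'_def d by simp_all
    show ?thesis unfolding * d using [[linarith_split_limit = 30]] by (intro conjI; simp; linarith)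
  next
    case False
    then obtain d where d: "x = p + d" by (metis le_Suc_ex nat_le_linear)
    show ?thesis
    proof (cases "k \<le> r")
      case True
      then obtain e where e: "r = k + e" using le_Suc_ex by blast
      have *: "h = min t (w + d)" "c = p + (t - h)" "a = min t (w + (e + d))" "a' = min c (p + e)"
        using h_def c_def a a'_def d e by simp_all
      show ?thesis unfolding * d e using [[linarith_split_limit = 30]] by (intro conjI; simp; linarith)
    next
      case False
      then obtain e where e: "k = r + e" by (metis le_Suc_ex nat_le_linear)
      have 1: "x - (p + (k - r)) = d - e" "p + (k - r) = p + e" "r + (x - p) - k = d - e"
          "p + (r - k) = p" "p - x = 0"
        by (simp_all add: d e)
      have *: "h = min t (w + (d - e))" "c = min (p + e) (p + d) + (t - h)"
          "a = min t (w + (d - e))" "a' = min c p"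
        by (simp_all only: h_def c_def a a'_def 1, simp_all only: d add_0_right)
      show ?thesis unfolding * d e using [[linarith_split_limit = 30]] by (intro conjI; simp; linarith)
    qed
  qed
  then show "a' = min p x + (a-h)" "min k r + (c - a') = min k (r + (x - p)) + (t - a)" by auto
qed

text \<open>Bracket words form a monoid under concatenation, so cutting off a prefix of rows acts on the
  unmatched brackets exactly like cutting off the first row in the definition of \<open>reclose\<close>.\<close>

lemma reclose_append:
  assumes "a = min t (closers l + (openers l - closers m))"
  shows "reclose t (l @ m) = reclose a l @ reclose (min (closers m) (openers l) + (t - a)) m"
  using assms
proof (induction l arbitrary: t a)
  case (Cons y l)
  obtain w x where y: "y = (w, x)" by force
  define p r k where prk: "p = closers l" "r = openers l" "k = closers m"
  define h where "h = min t (w + (x - (p + (k - r))))"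
  define c where "c = min (p + (k - r)) x + (t - h)"
  define a' where "a' = min c (p + (r - k))"
  have a: "a = min t (w + (p - x) + (r + (x - p) - k))"
    using Cons.prems by (simp add: y prk)
  have h: "h = min a (w + (x - p))"
    unfolding a h_def using [[linarith_split_limit = 30]] by linarith
  have 1: "a' = min p x + (a - h)" and 2: "min k r + (c - a') = min k (r + (x - p)) + (t - a)"
    using reclose_append_aux[OF h_def c_def a'_def a] by blast+
  have "reclose t (y # l @ m) = (h, w + x - h) # reclose c (l @ m)"
    by (simp add: y Let_def closers_append h_def c_def prk)
  also have "reclose c (l @ m) = reclose a' l @ reclose (min k r + (c - a')) m"
    using Cons.IH[of a' c] by (simp add: prk a'_def)
  also have "(h, w + x - h) # \<dots> = reclose a (y # l) @ reclose (min k (r + (x - p)) + (t - a)) m"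
    by (simp add: y Let_def 2 flip: prk h 1)
  finally show ?case by (simp add: y prk)
qed (auto simp: min_def)

lemma reclose_appendE:
  assumes "t \<le> closers (l @ m) + openers (l @ m)"
  obtains a b where "a \<le> closers l + openers l" "b \<le> closers m + openers m"
    "reclose t (l @ m) = reclose a l @ reclose b m"
proof -
  define a where "a = min t (closers l + (openers l - closers m))"
  define b where "b = min (closers m) (openers l) + (t - a)"
  have "a \<le> closers l + openers l" "b \<le> closers m + openers m"
    using assms [[linarith_split_limit = 30]] unfolding closers_append openers_append a_def b_def
    by linarith+
  with that reclose_append[OF a_def] show thesis unfolding b_def by blast
qed

text \<open>Cutting off a prefix and then a suffix leaves an admissible target, so one reflection of
  the whole word acts on every block of rows as some reclosing.\<close>

lemma reclose_infixE:
  assumes "t \<le> closers l + openers l"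
  obtains a where "a \<le> closers (take n (drop k l)) + openers (take n (drop k l))"
    "take n (drop k (reclose t l)) = reclose a (take n (drop k l))"
proof -
  obtain b c where c: "c \<le> closers (drop k l) + openers (drop k l)"
    and k: "reclose t l = reclose b (take k l) @ reclose c (drop k l)"
    using reclose_appendE[of t "take k l" "drop k l"] assms
    unfolding append_take_drop_id by blast
  obtain a d where a: "a \<le> closers (take n (drop k l)) + openers (take n (drop k l))"
    and n: "reclose c (drop k l) = reclose a (take n (drop k l)) @ reclose d (drop n (drop k l))"
    using reclose_appendE[of c "take n (drop k l)" "drop n (drop k l)"] c
    unfolding append_take_drop_id by blast
  have "drop k (reclose t l) = reclose c (drop k l)"
    by (cases "k \<le> length l") (auto simp: k)
  moreover have "take n (reclose c (drop k l)) = reclose a (take n (drop k l))"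
    by (cases "n \<le> length (drop k l)") (auto simp: n)
  ultimately show thesis using a that by metis
qed

definition reflect :: "(nat \<times> nat) list \<Rightarrow> (nat \<times> nat) list" where
  "reflect l = reclose (openers l) l"

lemma length_reflect [simp]: "length (reflect l) = length l"
  by (simp add: reflect_def)

text \<open>The first reflection leaves \<open>closers l\<close> openers, so the second one restores
  the original number of closers.\<close>

lemma reflect_reflect [simp]: "reflect (reflect l) = l"
  by (simp add: reflect_def openers_reclose reclose_reclose reclose_closers)

section \<open>Last-passage times of two columns\<close>

text \<open>This is the maximal weight of a path that starts in the first row of the left column, ends in
  the last row of the right column and changes columns inside one row.\<close>

definition passage :: "(nat \<times> nat) list \<Rightarrow> nat" where
  "passage l = closers l + sum_list (map snd l)"

text \<open>The path either stays in the left column beyond the first row or crosses there; this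
  links the bracket formula to path maxima.\<close>

lemma passage_Cons:
  "passage ((w, x) # l) = w + max (passage l) (x + sum_list (map snd l))"
  by (auto simp: passage_def)

lemma passage_snoc:
  "passage (l @ [(w, x)]) = max (passage l) (sum_list (map fst l) + w) + x"
  by (induction l) (auto simp: passage_Cons, auto simp: passage_def)


lemma sum_list_map_add:
  "sum_list (map (\<lambda>(w, x). w + x) l) = sum_list (map fst l) + sum_list (map snd l :: nat list)"
  by (induction l) auto

lemma sum_map_reclose:
  "sum_list (map fst (reclose t l)) + sum_list (map snd (reclose t l)) = sum_list (map fst l) + sum_list (map snd l)"
  using arg_cong[OF sum_reclose[of t l], of sum_list] by (simp add: sum_list_map_add)

text \<open>By \<open>closers_balance\<close>, twice the passage time is the number of unmatched
  brackets plus the number of all brackets. Reclosing changes neither.\<close>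

lemma passage_reclose:
  assumes "t \<le> closers l + openers l"
  shows "passage (reclose t l) = passage l"
  using closers_balance[of l] closers_balance[of "reclose t l"] sum_map_reclose[of t l] assms
  by (simp add: closers_reclose openers_reclose passage_def)

lemma passage_reflect_infix:
  "passage (take n (drop k (reflect l))) = passage (take n (drop k l))"
  using reclose_infixE[of "openers l" l n k] passage_reclose unfolding reflect_def
  by (metis le_add2)

lemma sum_reflect_infix:
  "sum_list (map fst (take n (drop k (reflect l)))) + sum_list (map snd (take n (drop k (reflect l)))) =
   sum_list (map fst (take n (drop k l))) + sum_list (map snd (take n (drop k l)))"
  using reclose_infixE[of "openers l" l n k] sum_map_reclose unfolding reflect_def
  by (metis le_add2)

text \<open>A column sum counts the matched pairs and the unmatched brackets of one type; the
  reflection exchanges the latter numbers.\<close>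

lemma sum_reflect:
  "sum_list (map fst (reflect l)) = sum_list (map snd l)"
  "sum_list (map snd (reflect l)) = sum_list (map fst l)"
  using closers_balance[of l] closers_balance[of "reflect l"] sum_map_reclose[of "openers l" l]
  by (simp_all add: reflect_def closers_reclose openers_reclose)

text \<open>This keeps \<open>passage\<close> below the total of both columns, so the subtraction in
  \<open>avoidance\<close> is exact.\<close>

lemma closers_le: "closers l \<le> sum_list (map fst l)"
  by (induction l rule: closers.induct) auto

text \<open>The dual quantity for the stores: paths go from the right to the left column and skip one row
  (the one-slot delay between consecutive stores), and the weight is minimised.\<close>

definition avoidance :: "(nat \<times> nat) list \<Rightarrow> nat" where
  "avoidance l = sum_list (map fst l) + sum_list (map snd l) - passage l"

lemma avoidance_snoc:
  "avoidance (l @ [(w, x)]) = min (avoidance l + w) (sum_list (map snd l))"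
  using closers_le[of l] unfolding avoidance_def passage_snoc
  by (simp add: passage_def)

section \<open>Departures in terms of two adjacent columns\<close>

definition row_pairs :: "(nat \<Rightarrow> nat \<Rightarrow> nat) \<Rightarrow> nat \<Rightarrow> nat \<Rightarrow> nat \<Rightarrow> (nat \<times> nat) list" where
  "row_pairs v j m n = map (\<lambda>i. (v i j, v i (Suc j))) [m..<Suc n]"

lemma row_pairs_empty: "n < m \<Longrightarrow> row_pairs v j m n = []"
  by (simp add: row_pairs_def)

lemma row_pairs_Suc:
  "m \<le> Suc n \<Longrightarrow> row_pairs v j m (Suc n) = row_pairs v j m n @ [(v (Suc n) j, v (Suc n) (Suc j))]"
  by (simp add: row_pairs_def)

lemma sum_row_pairs:
  "sum_list (map fst (row_pairs v j m n)) = (\<Sum>i=m..n. v i j)"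
  "sum_list (map snd (row_pairs v j m n)) = (\<Sum>i=m..n. v i (Suc j))"
  by (simp_all add: row_pairs_def o_def sum_list_distinct_conv_sum_set atLeastLessThanSuc_atLeastAtMost
      del: upt_Suc)

lemma departure_time_0 [simp]: "departure_time v n 0 = 0"
  by (cases n) auto

text \<open>The max-plus solution of the recursion, phrased by upper bounds \<open>t\<close> so that
  the empty maximum at \<open>n = 0\<close> needs no convention.\<close>

lemma departure_time_le_iff:
  "departure_time v n (Suc j) \<le> t \<longleftrightarrow>
     (\<forall>m\<in>{1..n}. departure_time v m j + (\<Sum>i=m..n. v i (Suc j)) \<le> t)"
proof (induction n arbitrary: t)
  case (Suc n)
  let ?w = "v (Suc n) (Suc j)"
  have "departure_time v (Suc n) (Suc j) \<le> t \<longleftrightarrow>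
    departure_time v n (Suc j) \<le> t - ?w \<and> departure_time v (Suc n) j + ?w \<le> t"
    by auto
  also have "departure_time v n (Suc j) \<le> t - ?w \<longleftrightarrow>
    (\<forall>m\<in>{1..n}. departure_time v m j + (\<Sum>i=m..n. v i (Suc j)) \<le> t - ?w)"
    by (rule Suc.IH)
  finally show ?case
    by (auto simp: atLeastAtMostSuc_conv le_diff_conv2 add.assoc simp del: departure_time.simps)
qed simp

text \<open>Paths enter the pair of columns in row \<open>m\<close> and cross both at once, so only
  passage times of the pair appear.\<close>

lemma departure_time_le_iff_rows:
  "departure_time v n (Suc (Suc j)) \<le> t \<longleftrightarrow>
     (\<forall>m\<in>{1..n}. departure_time v m j + passage (row_pairs v (Suc j) m n) \<le> t)"
proof (induction n arbitrary: t)
  case (Suc n)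
  let ?x = "v (Suc n) (Suc (Suc j))"
  have eq: "departure_time v m j + passage (row_pairs v (Suc j) m (Suc n)) \<le> t \<longleftrightarrow> ?x \<le> t \<and>
      (m \<le> n \<longrightarrow> departure_time v m j + passage (row_pairs v (Suc j) m n) \<le> t - ?x) \<and>
      departure_time v m j + (\<Sum>i=m..Suc n. v i (Suc j)) \<le> t - ?x" if "m \<in> {1..Suc n}" for m
  proof (cases "m \<le> n")
    case True
    then show ?thesis by (auto simp: row_pairs_Suc passage_snoc sum_row_pairs)
  next
    case False
    with that have m: "m = Suc n" by simp
    have "passage (row_pairs v (Suc j) (Suc n) (Suc n)) = v (Suc n) (Suc j) + ?x"
      by (simp add: row_pairs_Suc row_pairs_empty passage_def)
    then show ?thesis unfolding m by (auto simp del: departure_time.simps)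
  qed
  have "departure_time v (Suc n) (Suc (Suc j)) \<le> t \<longleftrightarrow> ?x \<le> t \<and>
    departure_time v n (Suc (Suc j)) \<le> t - ?x \<and> departure_time v (Suc n) (Suc j) \<le> t - ?x"
    unfolding departure_time.simps(3)[of v n "Suc j"] by linarith
  also have "\<dots> \<longleftrightarrow> (\<forall>m\<in>{1..Suc n}. ?x \<le> t \<and>
      (m \<le> n \<longrightarrow> departure_time v m j + passage (row_pairs v (Suc j) m n) \<le> t - ?x) \<and>
      departure_time v m j + (\<Sum>i=m..Suc n. v i (Suc j)) \<le> t - ?x)"
    unfolding Suc.IH departure_time_le_iff[of v "Suc n" j] by fastforce
  also have "\<dots> \<longleftrightarrow> (\<forall>m\<in>{1..Suc n}. departure_time v m j + passage (row_pairs v (Suc j) m (Suc n)) \<le> t)"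
    using eq by (intro ball_cong) blast+
  finally show ?case .
qed simp

text \<open>Stores are indexed by the column of their requests: store \<open>k\<close> has column \<open>K + 1 - k\<close>.\<close>

definition column_departures :: "nat \<Rightarrow> (nat \<Rightarrow> nat \<Rightarrow> nat) \<Rightarrow> nat \<Rightarrow> nat \<Rightarrow> nat" where
  "column_departures K v c n = (\<Sum>i=1..n. store_departure K v (K + 1 - c) i)"

lemma column_departures_0 [simp]: "column_departures K v c 0 = 0"
  by (simp add: column_departures_def)

lemma cumulative_departures_eq: "cumulative_departures K v = column_departures K v 1"
  by (simp add: fun_eq_iff cumulative_departures_def column_departures_def)

lemma column_departures_last: "column_departures K v K n = (\<Sum>i=1..n. v i K)"
  by (induction n) (auto simp: column_departures_def)

text \<open>Conservation of stock; the one-slot delay of the supply gives the limit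
  \<open>n - 1\<close>.\<close>

lemma store_level_balance:
  assumes "2 \<le> k"
  shows "store_level K v k n + (\<Sum>i=1..n. store_departure K v k i) =
    (\<Sum>i=1..n - 1. store_departure K v (k - 1) i)"
proof (induction n)
  case (Suc n)
  have "store_departure K v k (Suc n) \<le> store_level K v k n + store_departure K v (k - 1) n"
    using assms by simp
  then have "store_level K v k (Suc n) + (\<Sum>i=1..Suc n. store_departure K v k i) =
    store_level K v k n + (\<Sum>i=1..n. store_departure K v k i) + store_departure K v (k - 1) n"
    by (simp del: store_departure.simps)
  also have "\<dots> = (\<Sum>i=1..n. store_departure K v (k - 1) i)"
    unfolding Suc.IH by (cases n) (simp_all del: store_departure.simps(2))
  finally show ?case by simp
qed simp

text \<open>By conservation, the cap by the available stock becomes a cap by the cumulative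
  departures of the preceding store: the min-plus dual of the queue recursion.\<close>

lemma column_departures_Suc:
  assumes "1 \<le> c" "c < K"
  shows "column_departures K v c (Suc n) =
    min (column_departures K v (Suc c) n) (column_departures K v c n + v (Suc n) c)"
proof -
  define k where "k = K + 1 - c"
  have k: "2 \<le> k" "k - 1 = K + 1 - Suc c" "K + 1 - k = c"
    using assms by (auto simp: k_def)
  define L where "L = store_level K v k n + store_departure K v (k - 1) n"
  have c: "column_departures K v c = (\<lambda>n. \<Sum>i=1..n. store_departure K v k i)"
    by (simp only: column_departures_def k_def fun_eq_iff) simp
  have Suc_c: "column_departures K v (Suc c) = (\<lambda>n. \<Sum>i=1..n. store_departure K v (k - 1) i)"
    by (simp only: column_departures_def k(2) fun_eq_iff) simp
  have "L + column_departures K v c n = column_departures K v (Suc c) n"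
    using store_level_balance[OF k(1), of K v n] unfolding c Suc_c L_def
    by (cases n) (simp_all del: store_departure.simps(2) store_level.simps(2))
  moreover have "store_departure K v k (Suc n) = min L (v (Suc n) c)"
    using k(1) by (simp only: store_departure.simps(2) L_def k(3)) simp
  then have "column_departures K v c (Suc n) = column_departures K v c n + min L (v (Suc n) c)"
    unfolding c by (simp del: store_departure.simps(2))
  ultimately show ?thesis by linarith
qed

text \<open>Think of \<open>m\<close> as the last slot in which the stock is exhausted: by then all
  supply has left, and later requests are met in full. The first bound covers the case without such
  a slot.\<close>

lemma column_departures_ge_iff:
  assumes "1 \<le> c" "c \<le> K"
  shows "t \<le> column_departures K v c n \<longleftrightarrow> t \<le> (\<Sum>i=1..n. v i c) \<and>
    (c < K \<longrightarrow> (\<forall>m\<in>{1..n}. t \<le> column_departures K v (Suc c) (m - 1) + (\<Sum>i=Suc m..n. v i c)))"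
proof (cases "c = K")
  case True
  then show ?thesis by (simp add: column_departures_last)
next
  case False
  with assms have c: "c < K" by simp
  show ?thesis
  proof (induction n arbitrary: t)
    case (Suc n)
    have "t \<le> column_departures K v c (Suc n) \<longleftrightarrow>
      t \<le> column_departures K v (Suc c) n \<and> t - v (Suc n) c \<le> column_departures K v c n"
      using assms c by (auto simp: column_departures_Suc)
    then show ?case
      using c unfolding Suc.IH by (auto simp: atLeastAtMostSuc_conv le_diff_conv add.assoc)
  qed simp
qed

text \<open>Row \<open>m\<close> is skipped on entering the pair of columns and a further row inside
  it, hence \<open>m < n\<close>. The first bound belongs to paths that stay in the pair.\<close>

lemma column_departures_ge_iff_rows:
  assumes "1 \<le> j" "Suc j \<le> K"
  shows "t \<le> column_departures K v j n \<longleftrightarrow> t \<le> avoidance (row_pairs v j 1 n) \<and>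
    (Suc j < K \<longrightarrow> (\<forall>m\<in>{1..<n}.
       t \<le> column_departures K v (Suc (Suc j)) (m - 1) + avoidance (row_pairs v j (Suc m) n)))"
proof (induction n arbitrary: t)
  case 0
  then show ?case by (simp add: row_pairs_empty avoidance_def)
next
  case (Suc n)
  let ?w = "v (Suc n) j"
  let ?D = "\<lambda>m. column_departures K v (Suc (Suc j)) (m - 1)"
  have avoidance_Suc: "avoidance (row_pairs v j m (Suc n)) =
      min (avoidance (row_pairs v j m n) + ?w) (\<Sum>i=m..n. v i (Suc j))" if "m \<le> Suc n" for m
    using that by (simp add: row_pairs_Suc avoidance_snoc sum_row_pairs)
  \<comment> \<open>For \<open>m = n\<close> the only row left is \<open>Suc n\<close>, which is
    then the skipped one.\<close>
  have eq: "t \<le> ?D m + avoidance (row_pairs v j (Suc m) (Suc n)) \<longleftrightarrow>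
      t \<le> ?D m + (\<Sum>i=Suc m..n. v i (Suc j)) \<and>
      (m < n \<longrightarrow> t - ?w \<le> ?D m + avoidance (row_pairs v j (Suc m) n))" if "m \<in> {1..n}" for m
    using that by (cases "m < n") (auto simp: avoidance_Suc)
  have "t \<le> column_departures K v j (Suc n) \<longleftrightarrow>
      t \<le> column_departures K v (Suc j) n \<and> t - ?w \<le> column_departures K v j n"
    using assms by (auto simp: column_departures_Suc)
  also have "\<dots> \<longleftrightarrow> t \<le> avoidance (row_pairs v j 1 (Suc n)) \<and>
    (Suc j < K \<longrightarrow> (\<forall>m\<in>{1..n}. t \<le> ?D m + (\<Sum>i=Suc m..n. v i (Suc j)) \<and>
      (m < n \<longrightarrow> t - ?w \<le> ?D m + avoidance (row_pairs v j (Suc m) n))))"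
    unfolding Suc.IH column_departures_ge_iff[OF le_SucI[OF assms(1)] assms(2)] avoidance_Suc[OF le_add1[of 1 n, unfolded plus_1_eq_Suc]]
      min.bounded_iff le_diff_conv by fastforce
  also have "\<dots> \<longleftrightarrow> t \<le> avoidance (row_pairs v j 1 (Suc n)) \<and>
    (Suc j < K \<longrightarrow> (\<forall>m\<in>{1..<Suc n}. t \<le> ?D m + avoidance (row_pairs v j (Suc m) (Suc n))))"
  proof -
    have "(\<forall>m\<in>{1..<Suc n}. t \<le> ?D m + avoidance (row_pairs v j (Suc m) (Suc n))) \<longleftrightarrow>
      (\<forall>m\<in>{1..n}. t \<le> ?D m + (\<Sum>i=Suc m..n. v i (Suc j)) \<and>
        (m < n \<longrightarrow> t - ?w \<le> ?D m + avoidance (row_pairs v j (Suc m) n)))"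
      unfolding atLeastLessThanSuc_atLeastAtMost by (intro ball_cong refl eq)
    then show ?thesis by (simp only:)
  qed
  finally show ?case .
qed

section \<open>Departures under a change of two adjacent columns\<close>

lemma departure_time_cong:
  assumes "\<And>i. i \<in> {1..N} \<Longrightarrow> v' i (Suc c) = v i (Suc c)"
    and "\<And>n. n \<le> N \<Longrightarrow> departure_time v' n c = departure_time v n c" and "n \<le> N"
  shows "departure_time v' n (Suc c) = departure_time v n (Suc c)"
  using \<open>n \<le> N\<close> by (induction n) (auto simp: assms)

lemma column_departures_cong:
  assumes "1 \<le> c" "c \<le> K" "\<And>i. i \<in> {1..N} \<Longrightarrow> v' i c = v i c"
    and "\<And>n. c < K \<Longrightarrow> n \<le> N \<Longrightarrow> column_departures K v' (Suc c) n = column_departures K v (Suc c) n"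
    and "n \<le> N"
  shows "column_departures K v' c n = column_departures K v c n"
proof (cases "c = K")
  case True
  with assms show ?thesis by (auto simp: column_departures_last intro!: sum.cong)
next
  case False
  with assms have "c < K" by simp
  then show ?thesis
    using \<open>n \<le> N\<close> by (induction n) (use assms in \<open>auto simp: column_departures_Suc\<close>)
qed

context
  fixes v v' :: "nat \<Rightarrow> nat \<Rightarrow> nat" and j N :: nat
  assumes j: "1 \<le> j"
    and other: "\<And>i c. i \<in> {1..N} \<Longrightarrow> c \<noteq> j \<Longrightarrow> c \<noteq> Suc j \<Longrightarrow> v' i c = v i c"
    and passage_eq: "\<And>m n. 1 \<le> m \<Longrightarrow> n \<le> N \<Longrightarrow> passage (row_pairs v' j m n) = passage (row_pairs v j m n)"
    and avoidance_eq: "\<And>m n. 1 \<le> m \<Longrightarrow> n \<le> N \<Longrightarrow> avoidance (row_pairs v' j m n) = avoidance (row_pairs v j m n)"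
begin

text \<open>Columns left of \<open>j\<close> agree, column \<open>Suc j\<close> is settled by the
  row formula, and the recursion goes on from there. Departures between the two queues may change,
  so column \<open>j\<close> is exempt.\<close>

lemma departure_time_eq:
  assumes "c \<noteq> j" "n \<le> N"
  shows "departure_time v' n c = departure_time v n c"
proof -
  have before: "n \<le> N \<Longrightarrow> departure_time v' n c = departure_time v n c" if "c < j" for n c
    using that
  proof (induction c arbitrary: n)
    case (Suc c)
    show ?case
      by (rule departure_time_cong[where N = N]) (use Suc other in auto)
  qed simp
  obtain k where k: "j = Suc k" using j by (cases j) auto
  have pair: "departure_time v' n (Suc j) = departure_time v n (Suc j)" if "n \<le> N" for n
  proof -
    have "departure_time v' n (Suc j) \<le> t \<longleftrightarrow> departure_time v n (Suc j) \<le> t" for t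
      using that before[of k] passage_eq unfolding k departure_time_le_iff_rows by simp
    then show ?thesis by (meson order_antisym order_refl)
  qed
  have "n \<le> N \<Longrightarrow> departure_time v' n c = departure_time v n c" if "Suc j \<le> c" for n
    using that
  proof (induction c arbitrary: n rule: dec_induct)
    case base
    then show ?case by (rule pair)
  next
    case (step c)
    show ?case
      by (rule departure_time_cong[where N = N]) (use step other in auto)
  qed
  with before assms show ?thesis by (cases "c < j") auto
qed

text \<open>Stores are traversed from column \<open>K\<close> downwards, so here the exempt column
  is \<open>Suc j\<close>.\<close>

lemma column_departures_eq:
  assumes "1 \<le> c" "Suc j \<le> K" "c \<le> K" "c \<noteq> Suc j" "n \<le> N"
  shows "column_departures K v' c n = column_departures K v c n"
proof -
  have after: "n \<le> N \<Longrightarrow> column_departures K v' c n = column_departures K v c n"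
    if "Suc j < c" "c \<le> K" for n c
    using that(2,1)
  proof (induction c arbitrary: n rule: inc_induct)
    case base
    show ?case
      by (rule column_departures_cong[where N = N]) (use base other in auto)
  next
    case (step c)
    show ?case
      by (rule column_departures_cong[where N = N]) (use step other in auto)
  qed
  have pair: "column_departures K v' j n = column_departures K v j n" if "n \<le> N" for n
  proof -
    have "t \<le> column_departures K v' j n \<longleftrightarrow> t \<le> column_departures K v j n" for t
    proof -
      have "column_departures K v' (Suc (Suc j)) (m - 1) = column_departures K v (Suc (Suc j)) (m - 1)"
        if "Suc j < K" "m \<in> {1..<n}" for m
        by (rule after) (use that \<open>n \<le> N\<close> in auto)
      then have "Suc j < K \<longrightarrow> (\<forall>m\<in>{1..<n}.
          t \<le> column_departures K v' (Suc (Suc j)) (m - 1) + avoidance (row_pairs v' j (Suc m) n)) =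
        (\<forall>m\<in>{1..<n}.
          t \<le> column_departures K v (Suc (Suc j)) (m - 1) + avoidance (row_pairs v j (Suc m) n))"
        using \<open>n \<le> N\<close> by (intro impI ball_cong refl) (simp add: avoidance_eq)
      then show ?thesis
        using avoidance_eq[of 1 n] \<open>n \<le> N\<close>
        unfolding column_departures_ge_iff_rows[OF j assms(2)] by auto
    qed
    then show ?thesis by (meson order_antisym order_refl)
  qed
  have "n \<le> N \<Longrightarrow> column_departures K v' c n = column_departures K v c n" if "c \<le> j" for n
    using that assms(1)
  proof (induction c arbitrary: n rule: inc_induct)
    case base
    then show ?case by (intro pair)
  next
    case (step c)
    show ?case
      by (rule column_departures_cong[where N = N]) (use step other assms in auto)
  qed
  with after assms show ?thesis by (cases "c \<le> j") auto
qed

end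

section \<open>Outputs and the reflection of arrays\<close>

definition outputs :: "nat \<Rightarrow> (nat \<Rightarrow> nat \<Rightarrow> nat) \<Rightarrow> nat \<Rightarrow> nat \<times> nat" where
  "outputs K v n = (departure_time v n K, cumulative_departures K v n)"

lemma outputs_cong:
  assumes "1 \<le> K" "n \<le> N" and eq: "\<And>i c. i \<in> {1..N} \<Longrightarrow> c \<in> {1..K} \<Longrightarrow> v' i c = v i c"
  shows "outputs K v' n = outputs K v n"
proof -
  have "c \<le> K \<Longrightarrow> n \<le> N \<Longrightarrow> departure_time v' n c = departure_time v n c" for c n
  proof (induction c arbitrary: n)
    case (Suc c)
    show ?case
      by (rule departure_time_cong[where N = N]) (use Suc eq in auto)
  qed simp
  moreover have "n \<le> N \<Longrightarrow> column_departures K v' 1 n = column_departures K v 1 n" for n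
    using \<open>1 \<le> K\<close>
  proof (induction arbitrary: n rule: inc_induct)
    case base
    show ?case
      by (rule column_departures_cong[where N = N]) (use base eq assms in auto)
  next
    case (step c)
    show ?case
      by (rule column_departures_cong[where N = N]) (use step eq in auto)
  qed
  ultimately show ?thesis using assms by (simp add: outputs_def cumulative_departures_eq)
qed

text \<open>Reflections for different horizons need not extend each other, so laws are compared
  horizon by horizon.\<close>

definition reflect_columns :: "nat \<Rightarrow> nat \<Rightarrow> (nat \<Rightarrow> nat \<Rightarrow> nat) \<Rightarrow> nat \<Rightarrow> nat \<Rightarrow> nat" where
  "reflect_columns N j v i c =
     (if i \<in> {1..N} \<and> c = j then fst (reflect (row_pairs v j 1 N) ! (i - 1))
      else if i \<in> {1..N} \<and> c = Suc j then snd (reflect (row_pairs v j 1 N) ! (i - 1))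
      else v i c)"

lemma length_row_pairs [simp]: "length (row_pairs v j m n) = Suc n - m"
  by (simp add: row_pairs_def del: upt_Suc)

lemma nth_row_pairs: "i < Suc n - m \<Longrightarrow> row_pairs v j m n ! i = (v (m + i) j, v (m + i) (Suc j))"
  by (simp add: row_pairs_def del: upt_Suc)

lemma row_pairs_reflect_columns:
  "row_pairs (reflect_columns N j v) j 1 N = reflect (row_pairs v j 1 N)"
  by (rule nth_equalityI) (auto simp: nth_row_pairs reflect_columns_def)

lemma row_pairs_infix:
  assumes "1 \<le> m" "n \<le> N"
  shows "row_pairs v j m n = take (Suc n - m) (drop (m - 1) (row_pairs v j 1 N))"
  by (rule nth_equalityI) (use assms in \<open>auto simp: nth_row_pairs\<close>)

lemma reflect_columns_involution: "reflect_columns N j (reflect_columns N j v) = v"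
proof (intro ext)
  fix i c
  show "reflect_columns N j (reflect_columns N j v) i c = v i c"
    unfolding reflect_columns_def[of N j "reflect_columns N j v"] row_pairs_reflect_columns
    by (auto simp: nth_row_pairs) (simp_all add: reflect_columns_def)
qed

lemma sum_reflect_columns:
  "(\<Sum>i=1..N. reflect_columns N j v i c) = (\<Sum>i=1..N. v i (Transposition.transpose j (Suc j) c))"
proof -
  consider "c = j" | "c = Suc j" | "c \<noteq> j" "c \<noteq> Suc j" by blast
  then show ?thesis
  proof cases
    case 1
    then show ?thesis
      using sum_row_pairs(1)[of "reflect_columns N j v" j 1 N]
      by (simp add: row_pairs_reflect_columns[simplified] sum_reflect sum_row_pairs)
  next
    case 2
    then show ?thesis
      using sum_row_pairs(2)[of "reflect_columns N j v" j 1 N]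
      by (simp add: row_pairs_reflect_columns[simplified] sum_reflect sum_row_pairs)
  next
    case 3
    then show ?thesis by (simp add: reflect_columns_def)
  qed
qed

lemma outputs_reflect_columns:
  assumes "1 \<le> j" "Suc j \<le> K" "n \<le> N"
  shows "outputs K (reflect_columns N j v) n = outputs K v n"
proof -
  let ?v = "reflect_columns N j v"
  have other: "?v i c = v i c" if "c \<noteq> j" "c \<noteq> Suc j" for i c
    using that by (simp add: reflect_columns_def)
  have pass: "passage (row_pairs ?v j m n) = passage (row_pairs v j m n)"
    and avoid: "avoidance (row_pairs ?v j m n) = avoidance (row_pairs v j m n)"
    if "1 \<le> m" "n \<le> N" for m n
    using that by (simp_all only: avoidance_def row_pairs_infix[of m n N] row_pairs_reflect_columns
        passage_reflect_infix sum_reflect_infix)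
  show ?thesis
    \<comment> \<open>Neither output lies in an exempt column, as \<open>K \<noteq> j\<close> and
      \<open>1 \<noteq> Suc j\<close>.\<close>
    using departure_time_eq[of j N ?v v K n, OF assms(1) other pass avoid]
      column_departures_eq[of j N ?v v 1 K n, OF assms(1) other pass avoid] assms
    by (simp add: outputs_def cumulative_departures_eq)
qed

section \<open>Laws of the outputs\<close>

text \<open>\<open>geometric_pmf\<close> takes the success probability, hence
  \<open>1 - q j\<close>. The default 0 off the grid leaves countably many possible arrays.\<close>

definition service_pmf :: "nat \<Rightarrow> nat \<Rightarrow> (nat \<Rightarrow> real) \<Rightarrow> (nat \<times> nat \<Rightarrow> nat) pmf" where
  "service_pmf K N q = Pi_pmf ({1..N} \<times> {1..K}) 0 (\<lambda>(i, j). geometric_pmf (1 - q j))"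

definition output_pmf :: "nat \<Rightarrow> nat \<Rightarrow> (nat \<Rightarrow> real) \<Rightarrow> (nat \<Rightarrow> nat \<times> nat) pmf" where
  "output_pmf K N q = map_pmf (\<lambda>A. restrict (outputs K (curry A)) {1..N}) (service_pmf K N q)"

lemma pmf_service_pmf:
  assumes "\<forall>j\<in>{1..K}. 0 < q j \<and> q j < 1"
  shows "pmf (service_pmf K N q) A = (if \<forall>x. x \<notin> {1..N} \<times> {1..K} \<longrightarrow> A x = 0
     then \<Prod>j=1..K. (1 - q j) ^ N * q j ^ (\<Sum>i=1..N. A (i, j)) else 0)"
proof -
  have "(\<Prod>x\<in>{1..N} \<times> {1..K}. pmf (case x of (i, j) \<Rightarrow> geometric_pmf (1 - q j)) (A x)) =
      (\<Prod>(i, j)\<in>{1..N} \<times> {1..K}. (1 - q j) * q j ^ A (i, j))"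
    by (rule prod.cong) (use assms in \<open>auto simp: less_imp_le\<close>)
  also have "\<dots> = (\<Prod>i=1..N. \<Prod>j=1..K. (1 - q j) * q j ^ A (i, j))"
    by (rule prod.cartesian_product[symmetric])
  also have "\<dots> = (\<Prod>j=1..K. \<Prod>i=1..N. (1 - q j) * q j ^ A (i, j))"
    by (rule prod.swap)
  also have "\<dots> = (\<Prod>j=1..K. (1 - q j) ^ N * q j ^ (\<Sum>i=1..N. A (i, j)))"
    by (simp add: prod.distrib power_sum)
  finally show ?thesis
    by (simp only: service_pmf_def pmf_Pi finite_cartesian_product finite_atLeastAtMost)
qed

lemma permute_parameters:
  assumes "p permutes {1..K}" "\<forall>j\<in>{1..K}. 0 < q j \<and> q j < 1"
  shows "\<forall>j\<in>{1..K}. 0 < (q \<circ> p) j \<and> (q \<circ> p) j < 1"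
  using assms(2) permutes_in_image[OF assms(1)] by simp

lemma output_pmf_transpose_Suc:
  assumes j: "1 \<le> j" "Suc j \<le> K" and q: "\<forall>j\<in>{1..K}. 0 < q j \<and> q j < 1"
  shows "output_pmf K N (q \<circ> Transposition.transpose j (Suc j)) = output_pmf K N q"
proof -
  let ?\<tau> = "Transposition.transpose j (Suc j)"
  define \<Phi> where "\<Phi> = (\<lambda>A. case_prod (reflect_columns N j (curry A)))"
  have \<Phi>\<Phi>: "\<Phi> (\<Phi> A) = A" for A
    by (simp add: \<Phi>_def reflect_columns_involution)
  then have "inj \<Phi>" by (metis injI)
  have perm: "?\<tau> permutes {1..K}"
    using j by (intro permutes_swap_id) auto
  note q\<tau> = permute_parameters[OF perm q]
  have supp: "\<forall>x. x \<notin> {1..N} \<times> {1..K} \<longrightarrow> \<Phi> A x = 0"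
    if "\<forall>x. x \<notin> {1..N} \<times> {1..K} \<longrightarrow> A x = 0" for A
    using that j by (auto simp: \<Phi>_def reflect_columns_def)
  have map: "map_pmf \<Phi> (service_pmf K N q) = service_pmf K N (q \<circ> ?\<tau>)"
  proof (rule pmf_eqI)
    fix A
    have "pmf (map_pmf \<Phi> (service_pmf K N q)) A = pmf (service_pmf K N q) (\<Phi> A)"
      using pmf_map_inj'[OF \<open>inj \<Phi>\<close>, of "service_pmf K N q" "\<Phi> A"] by (simp add: \<Phi>\<Phi>)
    also have "\<dots> = pmf (service_pmf K N (q \<circ> ?\<tau>)) A"
    proof (cases "\<forall>x. x \<notin> {1..N} \<times> {1..K} \<longrightarrow> A x = 0")
      case True
      have "(\<Prod>c=1..K. (1 - q c) ^ N * q c ^ (\<Sum>i=1..N. \<Phi> A (i, c))) =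
        (\<Prod>c=1..K. (1 - q c) ^ N * q c ^ (\<Sum>i=1..N. A (i, ?\<tau> c)))"
        by (simp only: \<Phi>_def case_prod_conv sum_reflect_columns curry_def)
      \<comment> \<open>Reindexing the product moves the transposition from the array to the
        parameters.\<close>
      also have "\<dots> = (\<Prod>c=1..K. (1 - q (?\<tau> c)) ^ N * q (?\<tau> c) ^ (\<Sum>i=1..N. A (i, ?\<tau> (?\<tau> c))))"
        by (subst prod.permute[OF perm]) (simp only: o_def)
      finally show ?thesis
        unfolding pmf_service_pmf[OF q] pmf_service_pmf[OF q\<tau>] if_P[OF True] if_P[OF supp[OF True]]
        by (simp only: o_def transpose_involutory)
    next
      case False
      then have "\<not> (\<forall>x. x \<notin> {1..N} \<times> {1..K} \<longrightarrow> \<Phi> A x = 0)"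
        using supp[of "\<Phi> A"] by (simp only: \<Phi>\<Phi>) blast
      with False show ?thesis
        by (simp only: pmf_service_pmf[OF q] pmf_service_pmf[OF q\<tau>] if_False)
    qed
    finally show "pmf (map_pmf \<Phi> (service_pmf K N q)) A = pmf (service_pmf K N (q \<circ> ?\<tau>)) A" .
  qed
  have "output_pmf K N (q \<circ> ?\<tau>) =
      map_pmf (\<lambda>A. restrict (outputs K (curry (\<Phi> A))) {1..N}) (service_pmf K N q)"
    unfolding output_pmf_def map[symmetric] by (simp add: pmf.map_comp o_def)
  also have "(\<lambda>A. restrict (outputs K (curry (\<Phi> A))) {1..N}) = (\<lambda>A. restrict (outputs K (curry A)) {1..N})"
    using j by (intro ext) (auto simp: \<Phi>_def restrict_def outputs_reflect_columns)
  finally show ?thesis by (simp only: output_pmf_def)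
qed

text \<open>Adjacent exchanges are composed to arbitrary transpositions by
  \<open>adj_transp_seq\<close>, and these to all permutations. Every stage holds for all
  \<open>q\<close>, because the inductions apply it to parameters already permuted.\<close>

lemma output_pmf_permute:
  assumes "\<sigma> permutes {1..K}" and "\<forall>j\<in>{1..K}. 0 < q j \<and> q j < 1"
  shows "output_pmf K N (q \<circ> \<sigma>) = output_pmf K N q"
proof -
  have adj: "output_pmf K N (q \<circ> apply_adj_transps xs) = output_pmf K N q"
    if "\<forall>x\<in>set xs. x \<in> {1..K} \<and> Suc x \<in> {1..K}" "\<forall>j\<in>{1..K}. 0 < q j \<and> q j < 1" for xs q
    using that
  proof (induction xs arbitrary: q)
    case (Cons x xs)
    let ?\<tau> = "Transposition.transpose x (Suc x)"
    have "?\<tau> permutes {1..K}"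
      using Cons.prems by (intro permutes_swap_id) auto
    from permute_parameters[OF this Cons.prems(2)]
    have "output_pmf K N ((q \<circ> ?\<tau>) \<circ> apply_adj_transps xs) = output_pmf K N (q \<circ> ?\<tau>)"
      using Cons.prems(1) by (intro Cons.IH) auto
    also have "\<dots> = output_pmf K N q"
      using Cons.prems by (intro output_pmf_transpose_Suc) auto
    finally show ?case by (simp only: apply_adj_transps_Cons comp_assoc Suc_eq_plus1)
  qed simp
  have less: "output_pmf K N (q \<circ> Transposition.transpose a b) = output_pmf K N q"
    if "a \<in> {1..K}" "b \<in> {1..K}" "a < b" "\<forall>j\<in>{1..K}. 0 < q j \<and> q j < 1" for a b q
    using adj[of "adj_transp_seq a b" q] that by (simp add: adj_transp_seq_correct set_adj_transp_seq)
  have transp: "output_pmf K N (q \<circ> Transposition.transpose a b) = output_pmf K N q"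
    if "a \<in> {1..K}" "b \<in> {1..K}" "a \<noteq> b" "\<forall>j\<in>{1..K}. 0 < q j \<and> q j < 1" for a b q
  proof (cases "a < b")
    case True
    with that show ?thesis by (intro less)
  next
    case False
    with that show ?thesis by (subst transpose_commute) (intro less, auto)
  qed
  show ?thesis
    using assms(1) finite_atLeastAtMost assms(2)
  proof (induction arbitrary: q rule: permutes_induct)
    case (swap a b p)
    let ?\<tau> = "Transposition.transpose a b"
    have "?\<tau> permutes {1..K}"
      using swap.hyps by (intro permutes_swap_id)
    from permute_parameters[OF this swap.prems]
    have "output_pmf K N ((q \<circ> ?\<tau>) \<circ> p) = output_pmf K N (q \<circ> ?\<tau>)"
      by (rule swap.IH)
    also have "\<dots> = output_pmf K N q"
      using swap.hyps swap.prems by (intro transp)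
    finally show ?case by (simp only: comp_assoc)
  qed simp
qed

section \<open>From service times to the law of the output sequence\<close>

lemma distr_eq_service_pmf:
  fixes u :: "nat \<Rightarrow> nat \<Rightarrow> 'a \<Rightarrow> nat"
  assumes "prob_space M" "geometric_service_times M K q u" "1 \<le> K" "1 \<le> N"
    and q: "\<forall>j\<in>{1..K}. 0 < q j \<and> q j < 1"
  defines "Y \<equiv> \<lambda>\<omega> (i, j). if (i, j) \<in> {1..N} \<times> {1..K} then u i j \<omega> else 0"
  shows "Y \<in> M \<rightarrow>\<^sub>M count_space UNIV"
    and "distr M (count_space UNIV) Y = measure_pmf (service_pmf K N q)"
proof -
  interpret prob_space M by fact
  let ?I = "{1..N} \<times> {1..K}"
  let ?u = "\<lambda>(i, j). u i j"
  \<comment> \<open>There are uncountably many arrays, but \<open>Y\<close> takes values in the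
    countable set \<open>S\<close>, so measurability and equality of laws reduce to
    singletons.\<close>
  define S where "S = PiE_dflt ?I (0::nat) (\<lambda>_. UNIV)"
  have "countable S"
    unfolding S_def dflt_image_PiE[symmetric] by (intro countable_image countable_PiE) auto
  have S: "A \<in> S \<longleftrightarrow> (\<forall>x. x \<notin> ?I \<longrightarrow> A x = 0)" for A
    by (auto simp: S_def PiE_dflt_def)
  have Y_in_S: "Y \<omega> \<in> S" for \<omega>
    by (auto simp: S Y_def)
  have ind: "indep_vars (\<lambda>_. count_space UNIV) ?u ?I"
    using assms(2) unfolding geometric_service_times_def
    by (auto intro: indep_vars_subset)
  then have rv: "random_variable (count_space UNIV) (?u x)" if "x \<in> ?I" for x
    using that unfolding indep_vars_def by auto
  have I: "?I \<noteq> {}" "finite ?I" using assms by auto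
  have vimage: "Y -` {A} \<inter> space M = (\<Inter>x\<in>?I. ?u x -` {A x} \<inter> space M)" if "A \<in> S" for A
    using that I(1) by (auto simp: S Y_def fun_eq_iff)
  have sets: "Y -` {A} \<inter> space M \<in> sets M" if "A \<in> S" for A
    unfolding vimage[OF that]
    by (intro sets.finite_INT I measurable_sets[OF rv]) auto
  have "Y \<in> M \<rightarrow>\<^sub>M count_space S"
    using sets Y_in_S by (subst measurable_count_space_eq_countable[OF \<open>countable S\<close>]) auto
  then show Y: "Y \<in> M \<rightarrow>\<^sub>M count_space UNIV"
    by (rule measurable_compose) simp
  have prob: "prob (Y -` {A} \<inter> space M) = pmf (service_pmf K N q) A" if "A \<in> S" for A
  proof -
    have "prob (?u x -` {A x} \<inter> space M) = pmf (case x of (i, j) \<Rightarrow> geometric_pmf (1 - q j)) (A x)"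
      if x: "x \<in> ?I" for x
    proof -
      obtain i j where ij: "x = (i, j)" "1 \<le> i" "j \<in> {1..K}" using x by auto
      have "?u x -` {A x} \<inter> space M = {\<omega> \<in> space M. u i j \<omega> = A x}" by (auto simp: ij)
      moreover have "0 < q j" "q j < 1" using q ij(3) by auto
      ultimately show ?thesis
        using assms(2) ij unfolding geometric_service_times_def by simp
    qed
    then have "(\<Prod>x\<in>?I. prob (?u x -` {A x} \<inter> space M)) =
        (\<Prod>x\<in>?I. pmf (case x of (i, j) \<Rightarrow> geometric_pmf (1 - q j)) (A x))"
      by (rule prod.cong[OF refl])
    also have "\<dots> = pmf (service_pmf K N q) A"
      unfolding service_pmf_def using S[of A] that I(2) by (intro pmf_Pi'[symmetric]) blast+
    finally show ?thesis
      unfolding vimage[OF that] by (subst indep_varsD_finite[OF ind I]) simp_all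
  qed
  show "distr M (count_space UNIV) Y = measure_pmf (service_pmf K N q)"
  proof (rule measure_eqI_countable_AE)
    show "AE A in distr M (count_space UNIV) Y. A \<in> S"
      using Y Y_in_S by (subst AE_distr_iff) auto
    show "AE A in measure_pmf (service_pmf K N q). A \<in> S"
      unfolding AE_measure_pmf_iff service_pmf_def S
      by (intro ballI) (rule subsetD[OF set_Pi_pmf_subset[OF I(2)], THEN CollectD])
    show "emeasure (distr M (count_space UNIV) Y) {A} = emeasure (measure_pmf (service_pmf K N q)) {A}"
      if "A \<in> S" for A
      using prob[OF that] Y by (simp add: emeasure_distr emeasure_eq_measure emeasure_pmf_single)
  qed (use \<open>countable S\<close> in auto)
qed

text \<open>On a cylinder with indices up to \<open>N\<close>, causality
  (\<open>outputs_cong\<close>) lets the truncated array \<open>Y N\<close> replace the infinite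
  one.\<close>

lemma
  fixes u :: "nat \<Rightarrow> nat \<Rightarrow> 'a \<Rightarrow> nat"
  assumes "prob_space M" "geometric_service_times M K q u" "1 \<le> K"
    and q: "\<forall>j\<in>{1..K}. 0 < q j \<and> q j < 1"
  shows prob_space_departure_law: "prob_space (departure_law M K u)"
    and emeasure_departure_law: "\<And>J N B. J \<subseteq> {1..N} \<Longrightarrow> 1 \<le> N \<Longrightarrow>
      emeasure (departure_law M K u) (prod_emb {1..} (\<lambda>_. count_space UNIV) J (Pi\<^sub>E J B)) =
      emeasure (measure_pmf (output_pmf K N q)) {f. \<forall>n\<in>J. f n \<in> B n}"
proof -
  interpret prob_space M by fact
  define Y where "Y = (\<lambda>N \<omega> (i, j). if (i, j) \<in> {1..N} \<times> {1..K} then u i j \<omega> else 0)"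
  have Y: "Y N \<in> M \<rightarrow>\<^sub>M count_space UNIV"
      "distr M (count_space UNIV) (Y N) = measure_pmf (service_pmf K N q)" if "1 \<le> N" for N
    using distr_eq_service_pmf[OF assms(1-3) that q] unfolding Y_def by blast+
  define X where "X = (\<lambda>\<omega>. \<lambda>n\<in>{1..}. outputs K (\<lambda>i j. u i j \<omega>) n)"
  have out: "outputs K (\<lambda>i j. u i j \<omega>) n = outputs K (curry (Y N \<omega>)) n" if "n \<le> N" for n N \<omega>
    using assms(3) that by (intro outputs_cong[where N = N]) (auto simp: Y_def)
  \<comment> \<open>With horizon \<open>n\<close> itself, the output factors through
    \<open>Y n\<close>, which is measurable into a discrete space.\<close>
  have "(\<lambda>\<omega>. outputs K (\<lambda>i j. u i j \<omega>) n) \<in> M \<rightarrow>\<^sub>M count_space UNIV" if "n \<in> {1..}" for n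
    using that unfolding out[OF order_refl] by (intro measurable_compose[OF Y(1)]) auto
  then have X: "X \<in> M \<rightarrow>\<^sub>M Pi\<^sub>M {1..} (\<lambda>_. count_space UNIV)"
    unfolding X_def by (rule measurable_restrict)
  have law: "departure_law M K u = distr M (Pi\<^sub>M {1..} (\<lambda>_. count_space UNIV)) X"
    by (simp add: departure_law_def X_def outputs_def)
  show "prob_space (departure_law M K u)"
    unfolding law by (rule prob_space_distr[OF X])
  show "emeasure (departure_law M K u) (prod_emb {1..} (\<lambda>_. count_space UNIV) J (Pi\<^sub>E J B)) =
      emeasure (measure_pmf (output_pmf K N q)) {f. \<forall>n\<in>J. f n \<in> B n}"
    if J: "J \<subseteq> {1..N}" and N: "1 \<le> N" for J N B
  proof -
    have "finite J" using J finite_subset by blast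
    have X_eq: "X \<omega> n = outputs K (curry (Y N \<omega>)) n" if "n \<in> J" for n \<omega>
      using that J out[of n N \<omega>] by (auto simp: X_def)
    have "X -` prod_emb {1..} (\<lambda>_. count_space UNIV) J (Pi\<^sub>E J B) \<inter> space M =
        Y N -` {A. \<forall>n\<in>J. outputs K (curry A) n \<in> B n} \<inter> space M"
      using measurable_space[OF X] by (auto simp: prod_emb_def space_PiM PiE_iff X_eq)
    moreover have "prod_emb {1..} (\<lambda>_. count_space UNIV) J (Pi\<^sub>E J B)
        \<in> sets (Pi\<^sub>M {1..} (\<lambda>_. count_space UNIV :: (nat \<times> nat) measure))"
      using J \<open>finite J\<close> by (intro sets_PiM_I) auto
    ultimately have "emeasure (departure_law M K u) (prod_emb {1..} (\<lambda>_. count_space UNIV) J (Pi\<^sub>E J B)) =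
        emeasure (distr M (count_space UNIV) (Y N)) {A. \<forall>n\<in>J. outputs K (curry A) n \<in> B n}"
      unfolding law using X Y(1)[OF N] by (simp only: emeasure_distr sets_count_space Pow_UNIV UNIV_I)
    also have "\<dots> = emeasure (measure_pmf (output_pmf K N q)) {f. \<forall>n\<in>J. f n \<in> B n}"
      unfolding Y(2)[OF N] output_pmf_def using J
      by (auto simp: subset_iff intro!: arg_cong[where f = "emeasure _"])
    finally show ?thesis .
  qed
qed

theorem theorem4:
  fixes K :: nat and q :: "nat \<Rightarrow> real" and \<sigma> :: "nat \<Rightarrow> nat"
    and M :: "'a measure" and M' :: "'b measure"
    and u :: "nat \<Rightarrow> nat \<Rightarrow> 'a \<Rightarrow> nat" and u' :: "nat \<Rightarrow> nat \<Rightarrow> 'b \<Rightarrow> nat"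
  assumes "K \<ge> 1"
    and "\<And>j. j \<in> {1..K} \<Longrightarrow> 0 < q j \<and> q j < 1"
    and "\<sigma> permutes {1..K}"
    and "prob_space M" and "geometric_service_times M K q u"
    and "prob_space M'" and "geometric_service_times M' K (\<lambda>j. q (\<sigma> j)) u'"
  shows "departure_law M K u = departure_law M' K u'"
proof (rule measure_eqI_PiM_infinite)
  have q: "\<forall>j\<in>{1..K}. 0 < q j \<and> q j < 1"
    using assms(2) by blast
  note q\<sigma> = permute_parameters[OF assms(3) q, unfolded o_def]
  note law = emeasure_departure_law[OF assms(4,5,1) q]
    and law' = emeasure_departure_law[OF assms(6,7,1) q\<sigma>]
  show "finite_measure (departure_law M K u)"
    using prob_space_departure_law[OF assms(4,5,1) q] prob_space.finite_measure by blast
  \<comment> \<open>Cylinders over finite index sets determine a finite measure on the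
    product.\<close>
  fix A :: "nat \<Rightarrow> (nat \<times> nat) set" and J :: "nat set"
  assume J: "finite J" "J \<subseteq> {1..}"
  \<comment> \<open>Inserting 1 keeps the horizon positive and covers an empty
    \<open>J\<close>.\<close>
  define N where "N = Max (insert 1 J)"
  have N: "1 \<le> N" "J \<subseteq> {1..N}"
    using J by (auto simp: N_def)
  have "output_pmf K N (q \<circ> \<sigma>) = output_pmf K N q"
    using assms(3) q by (rule output_pmf_permute)
  then show "emeasure (departure_law M K u) (prod_emb {1..} (\<lambda>_. count_space UNIV) J (Pi\<^sub>E J A)) =
      emeasure (departure_law M' K u') (prod_emb {1..} (\<lambda>_. count_space UNIV) J (Pi\<^sub>E J A))"
    unfolding law[OF N(2,1)] law'[OF N(2,1)] o_def by simp
qed (simp_all add: departure_law_def)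

end
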